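(* Let $X$ be a connected complex manifold, let $f:X\to X$ be holomorphic, let $u\in\mathcal{O}(X)$, and let $V\subset\mathcal{O}(X)$ be a complex topological vector space with continuous inclusion. Assume that the family $\{\delta_p|_V:p\in X\}$ is linearly independent in the continuous dual space $V'$, and that $uC_f$ is cyclic on $V$. Then, for every $r\ge1$ and every $\lambda\in\mathbb{C}$, $$\#\bigl(\mathcal{P}_r(f)\cap u_r^{-1}(\lambda)\bigr)\le r,$$ where $u_r:=\prod_{j=0}^{r-1}u\circ f^j$ and $\mathcal{P}_r(f):=\{p\in X:f^r(p)=p\}$. In particular, in the unweighted case $u\equiv1$, one has $\#\mathcal{P}_r(f)\le r$ for every $r\ge1$.
   Context: $\mathcal{O}(X)$ is the space of holomorphic functions on $X$ with the topology of uniform convergence on compact sets. "$V\subset\mathcal{O}(X)$ with continuous inclusion" means $V$ is a complex linear subspace of $\mathcal{O}(X)$ equipped with its own vector space topology such that the inclusion $V\hookrightarrow\mathcal{O}(X)$ is continuous. $\delta_p:\mathcal{O}(X)\to\mathbb{C}$, $h\mapsto h(p)$, is evaluation at $p$; linear independence of the family indexed by $p\in X$ means that $\delta_{p_1}|_V,\dots,\delta_{p_N}|_V$ are linearly independent for any finitely many distinct points $p_1,\dots,p_N$. The weighted composition operator $uC_f$ on $V$ is $h\mapsto u\cdot(h\circ f)$ with domain $D(uC_f)=\{h\in V:u\cdot(h\circ f)\in V\}$. $f^j$ is the $j$-th iterate of $f$. For a topological vector space $W$ and a densely defined linear operator $S$ on $W$ with domain $D(S)$, put $D(S^0):=W$,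 $D(S^{n+1}):=\{x\in D(S^n):S^nx\in D(S)\}$ for $n\ge0$, and $D_\infty(S):=\bigcap_{n\ge0}D(S^n)$. $S$ is cyclic if there is $x\in D_\infty(S)$ such that the linear span of $\{S^nx:n\ge0\}$ is dense in $W$. *)

theory Defs
  imports "HOL-Complex_Analysis.Complex_Analysis" "HOL-Library.Function_Algebras"
begin

section \<open>Complex manifolds\<close>

text \<open>
  The space of complex n-tuples is modelled inside \<^typ>\<open>nat \<Rightarrow> complex\<close> (with its product topology)
  by the sequences vanishing from index n on, so that the dimension n is an ordinary natural number
  and n = 0 is included.
\<close>

definition cspace :: "nat \<Rightarrow> (nat \<Rightarrow> complex) set" where
  "cspace n = {z. \<forall>i\<ge>n. z i = 0}"

text \<open>Holomorphy in several variables: continuous, and holomorphic in each variable separately.\<close>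

definition holomorphic_fun :: "nat \<Rightarrow> (nat \<Rightarrow> complex) set \<Rightarrow> ((nat \<Rightarrow> complex) \<Rightarrow> complex) \<Rightarrow> bool" where
  "holomorphic_fun n U g \<longleftrightarrow>
     continuous_on U g \<and>
     (\<forall>z\<in>U. \<forall>i<n. (\<lambda>t. g (z(i := t))) holomorphic_on {t. z(i := t) \<in> U})"

definition holomorphic_tuple ::
    "nat \<Rightarrow> (nat \<Rightarrow> complex) set \<Rightarrow> ((nat \<Rightarrow> complex) \<Rightarrow> (nat \<Rightarrow> complex)) \<Rightarrow> bool" where
  "holomorphic_tuple n U F \<longleftrightarrow> (\<forall>j<n. holomorphic_fun n U (\<lambda>z. F z j))"

type_synonym 'a chart = "'a set \<times> ('a \<Rightarrow> nat \<Rightarrow> complex)"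

definition is_chart :: "nat \<Rightarrow> 'a::topological_space chart \<Rightarrow> bool" where
  "is_chart n = (\<lambda>(U, \<phi>).
     open U \<and> openin (top_of_set (cspace n)) (\<phi> ` U) \<and>
     homeomorphism U (\<phi> ` U) \<phi> (inv_into U \<phi>))"

text \<open>
  The manifold is the whole type; Hausdorffness and second countability are its sort, and the
  complex structure is given by the atlas.
\<close>

definition complex_manifold ::
    "nat \<Rightarrow> 'a::{t2_space, second_countable_topology} chart set \<Rightarrow> bool" where
  "complex_manifold n A \<longleftrightarrow>
     (\<forall>c\<in>A. is_chart n c) \<and> (\<Union>c\<in>A. fst c) = UNIV \<and>
     (\<forall>(U, \<phi>)\<in>A. \<forall>(W, \<psi>)\<in>A. holomorphic_tuple n (\<phi> ` (U \<inter> W)) (\<psi> \<circ> inv_into U \<phi>))"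

definition holomorphic_functions ::
    "nat \<Rightarrow> 'a::{t2_space, second_countable_topology} chart set \<Rightarrow> ('a \<Rightarrow> complex) set" where
  "holomorphic_functions n A =
     {h. \<forall>(U, \<phi>)\<in>A. holomorphic_fun n (\<phi> ` U) (h \<circ> inv_into U \<phi>)}"

definition holomorphic_self_map ::
    "nat \<Rightarrow> 'a::{t2_space, second_countable_topology} chart set \<Rightarrow> ('a \<Rightarrow> 'a) \<Rightarrow> bool" where
  "holomorphic_self_map n A f \<longleftrightarrow>
     continuous_on UNIV f \<and>
     (\<forall>(U, \<phi>)\<in>A. \<forall>(W, \<psi>)\<in>A.
        holomorphic_tuple n (\<phi> ` (U \<inter> f -` W)) (\<psi> \<circ> f \<circ> inv_into U \<phi>))"

text \<open>
  The topology of uniform convergence on compact sets. The generating sets already form a basis: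
  a continuous function that is strictly below e on a compact set is bounded there by some e' < e.
\<close>

definition compact_convergence_topology ::
    "nat \<Rightarrow> 'a::{t2_space, second_countable_topology} chart set \<Rightarrow> ('a \<Rightarrow> complex) topology" where
  "compact_convergence_topology n A = topology_generated_by
     {{g \<in> holomorphic_functions n A. \<forall>x\<in>K. cmod (g x - h x) < e} | K h e.
        compact K \<and> h \<in> holomorphic_functions n A \<and> e > 0}"


section \<open>Topological vector spaces and cyclic operators\<close>

text \<open>
  The underlying set of the topological vector space is \<^term>\<open>topspace T\<close>, a linear subspace of an
  ambient vector space from which the operations are inherited.
\<close>

definition complex_tvs :: "(complex \<Rightarrow> 'w::ab_group_add \<Rightarrow> 'w) \<Rightarrow> 'w topology \<Rightarrow> bool" where
  "complex_tvs smul T \<longleftrightarrow>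
     vector_space smul \<and> module.subspace smul (topspace T) \<and>
     continuous_map (prod_topology T T) T (\<lambda>(x, y). x + y) \<and>
     continuous_map (prod_topology euclidean T) T (\<lambda>(c, x). smul c x)"

text \<open>An unbounded operator is a domain D together with a map S whose values off D are irrelevant.\<close>

definition densely_defined_operator ::
    "(complex \<Rightarrow> 'w::ab_group_add \<Rightarrow> 'w) \<Rightarrow> 'w topology \<Rightarrow> 'w set \<Rightarrow> ('w \<Rightarrow> 'w) \<Rightarrow> bool" where
  "densely_defined_operator smul T D S \<longleftrightarrow>
     D \<subseteq> topspace T \<and> module.subspace smul D \<and> T closure_of D = topspace T \<and>
     S ` D \<subseteq> topspace T \<and>
     (\<forall>x\<in>D. \<forall>y\<in>D. S (x + y) = S x + S y) \<and>
     (\<forall>c. \<forall>x\<in>D. S (smul c x) = smul c (S x))"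

primrec power_domain :: "'w topology \<Rightarrow> 'w set \<Rightarrow> ('w \<Rightarrow> 'w) \<Rightarrow> nat \<Rightarrow> 'w set" where
  "power_domain T D S 0 = topspace T"
| "power_domain T D S (Suc n) = {x \<in> power_domain T D S n. (S ^^ n) x \<in> D}"

definition smooth_domain :: "'w topology \<Rightarrow> 'w set \<Rightarrow> ('w \<Rightarrow> 'w) \<Rightarrow> 'w set" where
  "smooth_domain T D S = (\<Inter>n. power_domain T D S n)"

definition cyclic_operator ::
    "(complex \<Rightarrow> 'w::ab_group_add \<Rightarrow> 'w) \<Rightarrow> 'w topology \<Rightarrow> 'w set \<Rightarrow> ('w \<Rightarrow> 'w) \<Rightarrow> bool" where
  "cyclic_operator smul T D S \<longleftrightarrow>
     densely_defined_operator smul T D S \<and>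
     (\<exists>x\<in>smooth_domain T D S.
        T closure_of module.span smul (range (\<lambda>n. (S ^^ n) x)) = topspace T)"


section \<open>Weighted composition operators\<close>

definition fun_scale :: "complex \<Rightarrow> ('a \<Rightarrow> complex) \<Rightarrow> 'a \<Rightarrow> complex" where
  "fun_scale c h = (\<lambda>x. c * h x)"

lemma vector_space_fun_scale: "vector_space fun_scale"
  by unfold_locales (auto simp: fun_scale_def fun_eq_iff algebra_simps)

definition weighted_comp :: "('a \<Rightarrow> complex) \<Rightarrow> ('a \<Rightarrow> 'a) \<Rightarrow> ('a \<Rightarrow> complex) \<Rightarrow> 'a \<Rightarrow> complex" where
  "weighted_comp u f h = (\<lambda>x. u x * h (f x))"

definition weighted_comp_domain ::
    "('a \<Rightarrow> complex) set \<Rightarrow> ('a \<Rightarrow> complex) \<Rightarrow> ('a \<Rightarrow> 'a) \<Rightarrow> ('a \<Rightarrow> complex) set" where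
  "weighted_comp_domain V u f = {h \<in> V. weighted_comp u f h \<in> V}"

definition evaluation :: "'a \<Rightarrow> ('a \<Rightarrow> complex) \<Rightarrow> complex" where
  "evaluation p h = h p"

definition independent_evaluations_on :: "('a \<Rightarrow> complex) set \<Rightarrow> bool" where
  "independent_evaluations_on V \<longleftrightarrow>
     (\<forall>F c. finite F \<longrightarrow> (\<forall>h\<in>V. (\<Sum>p\<in>F. c p * evaluation p h) = 0) \<longrightarrow> (\<forall>p\<in>F. c p = 0))"

definition periodic_points :: "nat \<Rightarrow> ('a \<Rightarrow> 'a) \<Rightarrow> 'a set" where
  "periodic_points r f = {p. (f ^^ r) p = p}"

definition iterated_weight :: "('a \<Rightarrow> complex) \<Rightarrow> ('a \<Rightarrow> 'a) \<Rightarrow> nat \<Rightarrow> 'a \<Rightarrow> complex" where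
  "iterated_weight u f r = (\<lambda>x. \<Prod>j<r. u ((f ^^ j) x))"

end

theory Submission
  imports Defs
begin

text \<open>
  Fix \<open>r \<ge> 1\<close> and a value \<open>c\<close>, and let \<open>p\<close> be a point with \<open>f\<^sup>r p = p\<close> and \<open>u\<^sub>r p = c\<close>. Along the
  orbit of \<open>p\<close> the weights multiply and the points repeat, so that for the operator \<open>S = u C\<^sub>f\<close> and
  every function \<open>h\<close>

    \<open>(S\<^sup>q\<^sup>r\<^sup>+\<^sup>s h) p = c\<^sup>q (S\<^sup>s h) p\<close>.

  The factor \<open>c\<^sup>q\<close> is the same for all such points. Evaluated at finitely many of them, the
  whole orbit of \<open>h\<close> under \<open>S\<close> therefore stays in the span of the \<open>r\<close> vectors obtained from
  \<open>h, S h, \<dots>, S\<^sup>r\<^sup>-\<^sup>1 h\<close>. With more than \<open>r\<close> points these vectors cannot fill the space of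
  values, so a nontrivial combination of the evaluations kills the orbit, hence also its span.
  Evaluations are continuous on \<open>V\<close>, so if \<open>h\<close> is a cyclic vector the combination kills all
  of \<open>V\<close>, against the independence of the evaluations.

  The three ingredients are the periodicity formula (\<open>orbit_at_periodic_point\<close>), the existence
  of a nontrivial solution of an underdetermined system (\<open>underdetermined_system\<close>), and
  the passage from a dense span to the whole space (\<open>evaluations_vanish_of_dense_span\<close>).
\<close>

text \<open>
  Gaussian elimination: a form that does not vanish at some \<open>q\<close> is solved for the unknown
  at \<open>q\<close>, which leaves one form and one unknown fewer.
\<close>

lemma underdetermined_system:
  fixes a :: "nat \<Rightarrow> 'a \<Rightarrow> 'k::field"
  assumes "finite F" "r < card F"
  shows "\<exists>c. (\<forall>s<r. (\<Sum>p\<in>F. c p * a s p) = 0) \<and> (\<exists>p\<in>F. c p \<noteq> 0)"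
  using assms
proof (induction r arbitrary: F a)
  case 0
  then have "F \<noteq> {}" by auto
  then show ?case by (intro exI[of _ "\<lambda>_. 1"]) auto
next
  case (Suc r)
  show ?case
  proof (cases "\<forall>p\<in>F. a r p = 0")
    case True
    from Suc.IH[of F a] Suc.prems obtain c
      where c: "\<forall>s<r. (\<Sum>p\<in>F. c p * a s p) = 0" "\<exists>p\<in>F. c p \<noteq> 0" by auto
    have "(\<Sum>p\<in>F. c p * a s p) = 0" if "s < Suc r" for s
    proof (cases "s = r")
      case False
      with that c(1) show ?thesis by simp
    qed (use True in simp)
    with c(2) show ?thesis by blast
  next
    case False
    then obtain q where q: "q \<in> F" "a r q \<noteq> 0" by blast
    define G where "G = F - {q}"
    have G: "finite G" "q \<notin> G" "F = insert q G" and "r < card G"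
      using q Suc.prems by (auto simp: G_def)
    define b where "b s p = a s p - a s q / a r q * a r p" for s p
    from Suc.IH[OF \<open>finite G\<close> \<open>r < card G\<close>, of b] obtain d
      where d: "\<forall>s<r. (\<Sum>p\<in>G. d p * b s p) = 0" "\<exists>p\<in>G. d p \<noteq> 0" by auto
    define c where "c = d(q := - (\<Sum>p\<in>G. d p * a r p) / a r q)"
    have "(\<Sum>p\<in>F. c p * a s p) = (\<Sum>p\<in>G. d p * b s p)" for s
    proof -
      have "(\<Sum>p\<in>G. c p * a s p) = (\<Sum>p\<in>G. d p * a s p)"
        using G(2) by (intro sum.cong) (auto simp: c_def)
      moreover have "(\<Sum>p\<in>G. d p * b s p)
          = (\<Sum>p\<in>G. d p * a s p) - a s q / a r q * (\<Sum>p\<in>G. d p * a r p)"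
        by (simp add: b_def right_diff_distrib sum_subtractf sum_distrib_left mult_ac)
      ultimately show ?thesis using G by (simp add: c_def)
    qed
    moreover have "b r p = 0" for p using q by (simp add: b_def)
    ultimately have "\<forall>s<Suc r. (\<Sum>p\<in>F. c p * a s p) = 0"
      using d(1) by (simp add: less_Suc_eq)
    moreover have "\<exists>p\<in>F. c p \<noteq> 0" using d(2) G by (auto simp: c_def)
    ultimately show ?thesis by blast
  qed
qed

lemma iterated_weight_add:
  "iterated_weight u f (m + k) x = iterated_weight u f m x * iterated_weight u f k ((f ^^ m) x)"
proof (induction k)
  case (Suc k)
  have "(f ^^ (m + k)) x = (f ^^ k) ((f ^^ m) x)"
    by (simp add: funpow_add add.commute[of m])
  with Suc show ?case by (simp add: iterated_weight_def)
qed (simp add: iterated_weight_def)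

lemma funpow_weighted_comp:
  "(weighted_comp u f ^^ k) h x = iterated_weight u f k x * h ((f ^^ k) x)"
proof (induction k arbitrary: x)
  case (Suc k)
  have "(weighted_comp u f ^^ Suc k) h x = u x * (weighted_comp u f ^^ k) h (f x)"
    by (simp add: weighted_comp_def)
  also have "\<dots> = (u x * iterated_weight u f k (f x)) * h ((f ^^ Suc k) x)"
    by (simp add: Suc.IH funpow_swap1)
  also have "u x * iterated_weight u f k (f x) = iterated_weight u f (Suc k) x"
    using iterated_weight_add[of u f 1 k x] by (simp add: iterated_weight_def)
  finally show ?case .
qed (simp add: iterated_weight_def)

text \<open>
  One turn around the orbit multiplies by the total weight \<open>c\<close>, so the values of the iterates
  at the point are governed by the first \<open>r\<close> of them.
\<close>

lemma orbit_at_periodic_point: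
  assumes "(f ^^ r) p = p" "iterated_weight u f r p = c"
  shows "(weighted_comp u f ^^ (q * r + s)) h p = c ^ q * (weighted_comp u f ^^ s) h p"
proof (induction q)
  case (Suc q)
  have "(weighted_comp u f ^^ (r + k)) h p = c * (weighted_comp u f ^^ k) h p" for k
    unfolding funpow_weighted_comp iterated_weight_add
    using assms by (simp add: funpow_add add.commute[of r])
  from this[of "q * r + s"] Suc show ?case by (simp add: add.assoc)
qed simp

text \<open>
  The singletons among the compact sets make evaluations continuous for compact convergence.
\<close>

lemma continuous_map_evaluation:
  assumes V: "continuous_map V (compact_convergence_topology n A) (\<lambda>h. h)"
    and sub: "topspace V \<subseteq> holomorphic_functions n A"
  shows "continuous_map V euclidean (\<lambda>h. h p)"
proof -
  have "openin V {h \<in> topspace V. h p \<in> U}" if "open U" for U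
  proof (subst openin_subopen, intro ballI)
    fix h assume "h \<in> {h \<in> topspace V. h p \<in> U}"
    then have h: "h \<in> topspace V" "h p \<in> U" by auto
    then obtain e where e: "e > 0" "ball (h p) e \<subseteq> U"
      using \<open>open U\<close> open_contains_ball by blast
    define W where "W = {g \<in> holomorphic_functions n A. \<forall>x\<in>{p}. cmod (g x - h x) < e}"
    have "openin (compact_convergence_topology n A) W"
      unfolding compact_convergence_topology_def
    proof (rule topology_generated_by_Basis)
      have "compact {p}" "h \<in> holomorphic_functions n A" using h(1) sub by auto
      with \<open>e > 0\<close> show "W \<in> {{g \<in> holomorphic_functions n A. \<forall>x\<in>K. cmod (g x - h x) < e} | K h e.
          compact K \<and> h \<in> holomorphic_functions n A \<and> e > 0}"
        unfolding W_def by blast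
    qed
    then have "openin V {g \<in> topspace V. g \<in> W}"
      using V openin_continuous_map_preimage by fastforce
    moreover have "h \<in> {g \<in> topspace V. g \<in> W}"
      using h(1) sub \<open>e > 0\<close> by (auto simp: W_def)
    moreover have "{g \<in> topspace V. g \<in> W} \<subseteq> {h \<in> topspace V. h p \<in> U}"
      using e(2) by (auto simp: W_def dist_norm norm_minus_commute)
    ultimately show "\<exists>T. openin V T \<and> h \<in> T \<and> T \<subseteq> {h \<in> topspace V. h p \<in> U}" by blast
  qed
  then show ?thesis by (simp add: continuous_map_def)
qed

text \<open>
  The kernel of a combination of evaluations is a closed subspace, so it contains the closed
  span of every set that it contains.
\<close>

lemma evaluations_vanish_of_dense_span:
  fixes V :: "('a \<Rightarrow> complex) topology"
  assumes eval: "\<And>p. continuous_map V euclidean (\<lambda>h. h p)"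
    and dense: "V closure_of (module.span fun_scale B) = topspace V"
    and fin: "finite F"
    and vanish: "\<And>h. h \<in> B \<Longrightarrow> (\<Sum>p\<in>F. c p * h p) = 0"
    and "h \<in> topspace V"
  shows "(\<Sum>p\<in>F. c p * h p) = 0"
proof -
  interpret vector_space "fun_scale :: complex \<Rightarrow> ('a \<Rightarrow> complex) \<Rightarrow> _"
    by (rule vector_space_fun_scale)
  let ?N = "{h. (\<Sum>p\<in>F. c p * h p) = 0}"
  have "subspace ?N"
  proof (rule subspaceI)
    fix a :: complex and h assume "h \<in> ?N"
    moreover have "(\<Sum>p\<in>F. c p * fun_scale a h p) = a * (\<Sum>p\<in>F. c p * h p)"
      by (simp add: fun_scale_def sum_distrib_left mult_ac)
    ultimately show "fun_scale a h \<in> ?N" by simp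
  qed (auto simp: distrib_left sum.distrib)
  then have span: "span B \<subseteq> ?N" using vanish by (intro span_minimal) auto
  have "continuous_map V euclidean (\<lambda>h. c p * h p)" for p
    using continuous_map_compose[OF eval[of p], of euclidean "(*) (c p)"]
    by (simp add: o_def continuous_on_mult_left)
  then have "continuous_map V euclidean (\<lambda>h. \<Sum>p\<in>F. c p * h p)"
    using fin by (intro continuous_map_sum)
  then have "closedin V {h \<in> topspace V. (\<Sum>p\<in>F. c p * h p) \<in> {0}}"
    by (rule closedin_continuous_map_preimage) simp
  moreover have "topspace V \<inter> span B \<subseteq> {h \<in> topspace V. (\<Sum>p\<in>F. c p * h p) \<in> {0}}"
    using span by auto
  ultimately have "V closure_of span B \<subseteq> {h \<in> topspace V. (\<Sum>p\<in>F. c p * h p) \<in> {0}}"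
    by (subst closure_of_restrict) (rule closure_of_minimal)
  with dense \<open>h \<in> topspace V\<close> show ?thesis by blast
qed

theorem theorem1p6:
  fixes A :: "'a::{t2_space, second_countable_topology} chart set"
    and n :: nat
    and f :: "'a \<Rightarrow> 'a"
    and u :: "'a \<Rightarrow> complex"
    and V :: "('a \<Rightarrow> complex) topology"
  assumes "complex_manifold n A"
    and "connected (UNIV :: 'a set)"
    and "holomorphic_self_map n A f"
    and "u \<in> holomorphic_functions n A"
    and "complex_tvs fun_scale V"
    and "topspace V \<subseteq> holomorphic_functions n A"
    and "continuous_map V (compact_convergence_topology n A) (\<lambda>h. h)"
    and "independent_evaluations_on (topspace V)"
    and "cyclic_operator fun_scale V (weighted_comp_domain (topspace V) u f) (weighted_comp u f)"
  shows "(\<forall>r\<ge>1. \<forall>c::complex.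
            finite (periodic_points r f \<inter> iterated_weight u f r -` {c}) \<and>
            card (periodic_points r f \<inter> iterated_weight u f r -` {c}) \<le> r) \<and>
         (u = (\<lambda>_. 1) \<longrightarrow>
            (\<forall>r\<ge>1. finite (periodic_points r f) \<and> card (periodic_points r f) \<le> r))"
proof -
  from assms(9) obtain h where dense: "V closure_of (module.span fun_scale
      (range (\<lambda>k. (weighted_comp u f ^^ k) h))) = topspace V"
    unfolding cyclic_operator_def by blast
  have bound: "finite P \<and> card P \<le> r"
    if "r \<ge> 1" and P: "P = periodic_points r f \<inter> iterated_weight u f r -` {c}" for r c P
  proof (rule ccontr)
    assume "\<not> (finite P \<and> card P \<le> r)"
    then obtain F where F: "finite F" "card F = Suc r" "F \<subseteq> P"
      by (metis infinite_arbitrarily_large not_less_eq_eq obtain_subset_with_card_n)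
    from F obtain d
      where d: "\<forall>s<r. (\<Sum>p\<in>F. d p * (weighted_comp u f ^^ s) h p) = 0" "\<exists>p\<in>F. d p \<noteq> 0"
      using underdetermined_system[of F r "\<lambda>s. (weighted_comp u f ^^ s) h"] by auto
    have "(\<Sum>p\<in>F. d p * (weighted_comp u f ^^ k) h p) = 0" for k
    proof -
      have "(weighted_comp u f ^^ k) h p
          = c ^ (k div r) * (weighted_comp u f ^^ (k mod r)) h p" if "p \<in> F" for p
        using orbit_at_periodic_point[of r f p u c "k div r" "k mod r" h] that F(3)
        by (auto simp: P periodic_points_def)
      then have "(\<Sum>p\<in>F. d p * (weighted_comp u f ^^ k) h p)
          = c ^ (k div r) * (\<Sum>p\<in>F. d p * (weighted_comp u f ^^ (k mod r)) h p)"
        unfolding sum_distrib_left by (intro sum.cong) auto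
      with d(1) \<open>r \<ge> 1\<close> show ?thesis by simp
    qed
    then have "(\<Sum>p\<in>F. d p * g p) = 0" if "g \<in> topspace V" for g
      using evaluations_vanish_of_dense_span[OF _ dense F(1) _ that]
        continuous_map_evaluation[OF assms(7) assms(6)] by blast
    then have "\<forall>p\<in>F. d p = 0"
      using assms(8) F(1) unfolding independent_evaluations_on_def evaluation_def by blast
    with d(2) show False by blast
  qed
  have "iterated_weight u f r -` {1} = UNIV" if "u = (\<lambda>_. 1)" for r
    using that by (auto simp: iterated_weight_def)
  then show ?thesis using bound[OF _ refl] by (metis inf_top_right)
qed

end
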